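(* If $S\subseteq\mathbb{R}^n$ is semidefinite representable, then its relative interior $\operatorname{relint}(S)$ is also semidefinite representable.
   Context: A linear matrix polynomial of dimension $k$ in $n$ variables is an expression $\mathscr{A}(X_1,\ldots,X_n)=A_0+X_1A_1+\cdots+X_nA_n$ with real symmetric $k\times k$ matrices $A_0,\ldots,A_n$. A spectrahedron in $\mathbb{R}^n$ is a set of the form $\{x\in\mathbb{R}^n\mid \mathscr{A}(x)\succeq 0\}$ for some linear matrix polynomial $\mathscr{A}$ in $n$ variables (of some dimension $k$), where $\succeq 0$ means positive semidefinite. A set $S\subseteq\mathbb{R}^n$ is semidefinite representable if it is the image of a spectrahedron under a linear projection, i.e. if $S=\{x\in\mathbb{R}^n\mid \exists y\in\mathbb{R}^m\ \mathscr{A}(x,y)\succeq 0\}$ for some $m\ge 0$ and some linear matrix polynomial $\mathscr{A}$ in $n+m$ variables. Semidefinite representable sets are convex, but need not be closed. The relative interior $\operatorname{relint}(S)$ of a convex set $S$ is the interior of $S$ in the affine hull of $S$. *)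

theory Defs
  imports "HOL-Analysis.Analysis" "Jordan_Normal_Form.Matrix"
begin

no_notation vec_index (infixl \<open>$\<close> 100)
no_notation inner (infixl \<open>\<bullet>\<close> 70)

definition positive_semidefinite :: "real mat \<Rightarrow> bool" where
  "positive_semidefinite M \<longleftrightarrow>
     transpose_mat M = M \<and> (\<forall>v \<in> carrier_vec (dim_row M). 0 \<le> v \<bullet> (M *\<^sub>v v))"

text \<open>
  The coefficients of a linear matrix polynomial of dimension \<open>k\<close> in variables indexed by a finite
  set \<open>I\<close>: the constant coefficient \<open>A0\<close> and one coefficient \<open>A i\<close> for every variable \<open>i \<in> I\<close>.
\<close>

definition linear_matrix_polynomial ::
  "nat \<Rightarrow> 'i set \<Rightarrow> real mat \<Rightarrow> ('i \<Rightarrow> real mat) \<Rightarrow> bool" where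
  "linear_matrix_polynomial k I A0 A \<longleftrightarrow> finite I \<and>
     A0 \<in> carrier_mat k k \<and> transpose_mat A0 = A0 \<and>
     (\<forall>i \<in> I. A i \<in> carrier_mat k k \<and> transpose_mat (A i) = A i)"

text \<open>
  The value \<open>A0 + (\<Sum>i\<in>I. z i * A i)\<close>, written entrywise because \<^typ>\<open>real mat\<close> comprises matrices
  of all sizes and hence has no zero element over which to sum.
\<close>

definition lmp_eval ::
  "nat \<Rightarrow> 'i set \<Rightarrow> real mat \<Rightarrow> ('i \<Rightarrow> real mat) \<Rightarrow> ('i \<Rightarrow> real) \<Rightarrow> real mat" where
  "lmp_eval k I A0 A z = Matrix.mat k k (\<lambda>(r, c). A0 $$ (r, c) + (\<Sum>i\<in>I. z i * A i $$ (r, c)))"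

text \<open>
  The \<open>n + m\<close> variables are indexed by the disjoint sum of the index type \<open>'n\<close> of the ambient space
  and \<open>{..<m}\<close>: the variable \<open>Inl i\<close> takes the value \<open>x $ i\<close> and \<open>Inr j\<close> the value of entry \<open>j\<close>
  of \<open>y\<close>. The number \<open>m\<close> of auxiliary variables and the dimension \<open>k\<close> are existentially
  quantified, so neither can be a type.
\<close>

definition semidefinite_representable :: "(real ^ 'n) set \<Rightarrow> bool" where
  "semidefinite_representable S \<longleftrightarrow>
     (\<exists>(m::nat) (k::nat) A0 (A :: 'n + nat \<Rightarrow> real mat).
        linear_matrix_polynomial k (UNIV <+> {..<m}) A0 A \<and>
        S = {x. \<exists>y \<in> carrier_vec m.
               positive_semidefinite
                 (lmp_eval k (UNIV <+> {..<m}) A0 A (case_sum (\<lambda>i. x $ i) (vec_index y)))})"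

end

theory Submission
  imports Defs
begin

text \<open>
  A semidefinite representable set \<open>S\<close> is convex. If it is nonempty it has a relative interior
  point \<open>x0\<close>, and the relative interior consists exactly of the points of \<open>S\<close>
  pulled a little way towards \<open>x0\<close>:
  the points \<open>x = t s + (1 - t) x0\<close> with \<open>s \<in> S\<close> and \<open>0 < t < 1\<close>
  (\<open>rel_interior_eq_open_segments\<close>). It remains to express this condition by a linear matrix
  inequality, with \<open>t\<close> as a further auxiliary variable.

  The condition \<open>s \<in> S\<close> says that \<open>A(s, w)\<close> is positive semidefinite for some \<open>w\<close>. For \<open>t > 0\<close>
  this is unaffected by scaling with \<open>t\<close>, and \<open>t A(s, w)\<close> depends only on \<open>t\<close>, \<open>t s\<close> and
  \<open>t w\<close>, and linearly so. Here \<open>t s = x - (1 - t) x0\<close> is affine in \<open>(x, t)\<close>, because \<open>x0\<close> is fixed,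
  and \<open>y = t w\<close> ranges over all vectors when \<open>w\<close> does. Hence \<open>t A(s, w)\<close> is the value of a linear
  matrix polynomial in \<open>(x, y, t)\<close> (\<open>lmp_eval_cone\<close>).

  The strict inequalities \<open>0 < t < 1\<close> describe a set that is not closed, so no linear matrix
  inequality in \<open>t\<close> alone expresses them; but \<open>t\<close> and \<open>1 - t\<close> are both positive iff some \<open>l\<close>
  satisfies \<open>t l \<ge> 1\<close> and \<open>(1 - t) l \<ge> 1\<close>, and one more auxiliary variable \<open>l\<close> turns this into a
  linear matrix inequality of dimension 3 (\<open>positive_semidefinite_interval_iff\<close>). The two matrix
  polynomials are combined into one as the diagonal blocks of a matrix of dimension \<open>k + 3\<close>.
\<close>

section \<open>Operations preserving positive semidefiniteness\<close>

lemma quadratic_form_expand: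
  fixes M :: "real mat"
  assumes "M \<in> carrier_mat k k" "v \<in> carrier_vec k"
  shows "v \<bullet> (M *\<^sub>v v) = (\<Sum>r<k. \<Sum>c<k. vec_index v r * (M $$ (r, c) * vec_index v c))"
  using assms by (simp add: scalar_prod_def sum_distrib_left atLeast0LessThan)

lemma positive_semidefinite_add:
  assumes "M \<in> carrier_mat k k" "N \<in> carrier_mat k k"
    "positive_semidefinite M" "positive_semidefinite N"
  shows "positive_semidefinite (M + N)"
proof -
  have "v \<bullet> ((M + N) *\<^sub>v v) = v \<bullet> (M *\<^sub>v v) + v \<bullet> (N *\<^sub>v v)" if "v \<in> carrier_vec k" for v
    using that assms(1,2)
    by (simp add: add_mult_distrib_mat_vec scalar_prod_add_distrib[of v k])
  then show ?thesis
    using assms by (simp add: positive_semidefinite_def transpose_add[of _ k k])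
qed

lemma positive_semidefinite_smult:
  assumes "M \<in> carrier_mat k k" "positive_semidefinite M" "0 \<le> a"
  shows "positive_semidefinite (a \<cdot>\<^sub>m M)"
proof -
  have "v \<bullet> ((a \<cdot>\<^sub>m M) *\<^sub>v v) = a * (v \<bullet> (M *\<^sub>v v))" if "v \<in> carrier_vec k" for v
    using that assms(1)
    by (simp add: quadratic_form_expand[of _ k] sum_distrib_left mult_ac)
  moreover have "(a \<cdot>\<^sub>m M)\<^sup>T = a \<cdot>\<^sub>m M\<^sup>T"
    by (intro eq_matI) auto
  ultimately show ?thesis
    using assms by (simp add: positive_semidefinite_def)
qed

lemma positive_semidefinite_smult_iff:
  assumes "M \<in> carrier_mat k k" "0 < a"
  shows "positive_semidefinite (a \<cdot>\<^sub>m M) \<longleftrightarrow> positive_semidefinite M"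
proof
  assume "positive_semidefinite (a \<cdot>\<^sub>m M)"
  moreover have "a \<cdot>\<^sub>m M \<in> carrier_mat k k" "0 \<le> inverse a"
    using assms by auto
  ultimately have "positive_semidefinite (inverse a \<cdot>\<^sub>m (a \<cdot>\<^sub>m M))"
    by (intro positive_semidefinite_smult[of "a \<cdot>\<^sub>m M" k])
  also have "inverse a \<cdot>\<^sub>m (a \<cdot>\<^sub>m M) = M"
    using assms by (intro eq_matI) auto
  finally show "positive_semidefinite M" .
qed (use assms positive_semidefinite_smult[of M k a] in auto)

definition block_sum :: "real mat \<Rightarrow> real mat \<Rightarrow> real mat" where
  "block_sum M N =
     four_block_mat M (0\<^sub>m (dim_row M) (dim_col N)) (0\<^sub>m (dim_row N) (dim_col M)) N"

lemma block_sum_carrier [simp]: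
  assumes "M \<in> carrier_mat k k" "N \<in> carrier_mat l l"
  shows "block_sum M N \<in> carrier_mat (k + l) (k + l)"
  using assms by (auto simp: block_sum_def)

lemma block_sum_transpose:
  assumes "M \<in> carrier_mat k k" "N \<in> carrier_mat l l"
  shows "(block_sum M N)\<^sup>T = block_sum (M\<^sup>T) (N\<^sup>T)"
  using assms by (simp add: block_sum_def transpose_four_block_mat[of _ k k _ l _ l])

lemma block_sum_inject:
  assumes "M \<in> carrier_mat k k" "M' \<in> carrier_mat k k"
    and "N \<in> carrier_mat l l" "N' \<in> carrier_mat l l"
  shows "block_sum M N = block_sum M' N' \<longleftrightarrow> M = M' \<and> N = N'"
proof (intro iffI conjI)
  assume eq: "block_sum M N = block_sum M' N'"
  show "M = M'"
  proof (intro eq_matI)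
    fix r c assume "r < dim_row M'" "c < dim_col M'"
    then show "M $$ (r, c) = M' $$ (r, c)"
      using assms arg_cong[OF eq, of "\<lambda>B. B $$ (r, c)"] by (simp add: block_sum_def)
  qed (use assms in auto)
  show "N = N'"
  proof (intro eq_matI)
    fix r c assume "r < dim_row N'" "c < dim_col N'"
    then show "N $$ (r, c) = N' $$ (r, c)"
      using assms arg_cong[OF eq, of "\<lambda>B. B $$ (k + r, k + c)"] by (simp add: block_sum_def)
  qed (use assms in auto)
qed simp

text \<open>
  This is what lets a single linear matrix inequality express a conjunction of two. The quadratic form
  of a block sum, evaluated at a concatenation of two vectors, is the sum of the two forms; padding
  with zeros isolates either of them.
\<close>

lemma positive_semidefinite_block_sum:
  assumes M: "M \<in> carrier_mat k k" and N: "N \<in> carrier_mat l l"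
  shows "positive_semidefinite (block_sum M N) \<longleftrightarrow>
    positive_semidefinite M \<and> positive_semidefinite N"
proof -
  have form: "(v @\<^sub>v w) \<bullet> (block_sum M N *\<^sub>v (v @\<^sub>v w)) = v \<bullet> (M *\<^sub>v v) + w \<bullet> (N *\<^sub>v w)"
    if "v \<in> carrier_vec k" "w \<in> carrier_vec l" for v w
  proof -
    have "block_sum M N *\<^sub>v (v @\<^sub>v w) = (M *\<^sub>v v) @\<^sub>v (N *\<^sub>v w)"
      using that M N unfolding block_sum_def
      by (subst four_block_mat_mult_vec[of _ k k _ l _ l]) auto
    then show ?thesis
      using that M N by (simp add: scalar_prod_append[of _ k _ l])
  qed
  have sym: "(block_sum M N)\<^sup>T = block_sum M N \<longleftrightarrow> M\<^sup>T = M \<and> N\<^sup>T = N"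
    using M N by (simp add: block_sum_transpose[of _ k _ l] block_sum_inject[of _ k _ _ l])
  have "(\<forall>u \<in> carrier_vec (k + l). 0 \<le> u \<bullet> (block_sum M N *\<^sub>v u)) \<longleftrightarrow>
    (\<forall>v \<in> carrier_vec k. 0 \<le> v \<bullet> (M *\<^sub>v v)) \<and> (\<forall>w \<in> carrier_vec l. 0 \<le> w \<bullet> (N *\<^sub>v w))"
    (is "?L \<longleftrightarrow> ?R")
  proof
    assume L: ?L
    show ?R
    proof (intro conjI ballI)
      fix v :: "real vec" assume v: "v \<in> carrier_vec k"
      have "0 \<le> (v @\<^sub>v 0\<^sub>v l) \<bullet> (block_sum M N *\<^sub>v (v @\<^sub>v 0\<^sub>v l))"
        using L v by auto
      then show "0 \<le> v \<bullet> (M *\<^sub>v v)"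
        using v M N form[of v "0\<^sub>v l"] by auto
    next
      fix w :: "real vec" assume w: "w \<in> carrier_vec l"
      have "0 \<le> (0\<^sub>v k @\<^sub>v w) \<bullet> (block_sum M N *\<^sub>v (0\<^sub>v k @\<^sub>v w))"
        using L w by auto
      then show "0 \<le> w \<bullet> (N *\<^sub>v w)"
        using w M N form[of "0\<^sub>v k" w] by auto
    qed
  next
    assume R: ?R
    show ?L
    proof
      fix u :: "real vec" assume u: "u \<in> carrier_vec (k + l)"
      have "u = vec_first u k @\<^sub>v vec_last u l"
        using u by simp
      then show "0 \<le> u \<bullet> (block_sum M N *\<^sub>v u)"
        using R form[of "vec_first u k" "vec_last u l"] by simp
    qed
  qed
  then show ?thesis
    using M N sym block_sum_carrier[OF M N] carrier_matD(1)
    unfolding positive_semidefinite_def by (metis (no_types, lifting))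
qed

section \<open>Linear matrix polynomials and convexity\<close>

lemma lmp_eval_carrier [simp]: "lmp_eval k I A0 A z \<in> carrier_mat k k"
  by (simp add: lmp_eval_def)

lemma lmp_eval_block_sum:
  assumes "A0 \<in> carrier_mat k k" "\<And>i. i \<in> I \<Longrightarrow> A i \<in> carrier_mat k k"
    and "B0 \<in> carrier_mat l l" "\<And>i. i \<in> I \<Longrightarrow> B i \<in> carrier_mat l l"
  shows "lmp_eval (k + l) I (block_sum A0 B0) (\<lambda>i. block_sum (A i) (B i)) z =
    block_sum (lmp_eval k I A0 A z) (lmp_eval l I B0 B z)"
proof -
  have dims: "dim_row (A i) = k" "dim_col (A i) = k" "dim_row (B i) = l" "dim_col (B i) = l"
    if "i \<in> I" for i
    using assms(2,4)[OF that] by auto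
  show ?thesis
    using assms(1,3) dims by (intro eq_matI) (auto simp: lmp_eval_def block_sum_def)
qed

lemma linear_matrix_polynomial_block_sum:
  assumes "linear_matrix_polynomial k I A0 A" "linear_matrix_polynomial l I B0 B"
  shows "linear_matrix_polynomial (k + l) I (block_sum A0 B0) (\<lambda>i. block_sum (A i) (B i))"
  using assms by (auto simp: linear_matrix_polynomial_def block_sum_transpose[of _ k _ l])

lemma sum_Plus:
  fixes f :: "'a + 'b \<Rightarrow> 'c::comm_monoid_add"
  assumes "finite A" "finite B"
  shows "(\<Sum>i\<in>A <+> B. f i) = (\<Sum>i\<in>A. f (Inl i)) + (\<Sum>j\<in>B. f (Inr j))"
  using assms by (simp add: sum.Plus)

lemma lmp_eval_affine:
  assumes "u + v = 1"
    and "\<And>i. i \<in> I \<Longrightarrow> z i = u * z1 i + v * z2 i"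
  shows "lmp_eval k I A0 A z = u \<cdot>\<^sub>m lmp_eval k I A0 A z1 + v \<cdot>\<^sub>m lmp_eval k I A0 A z2"
proof (intro eq_matI)
  fix r c assume "r < dim_row (u \<cdot>\<^sub>m lmp_eval k I A0 A z1 + v \<cdot>\<^sub>m lmp_eval k I A0 A z2)"
    "c < dim_col (u \<cdot>\<^sub>m lmp_eval k I A0 A z1 + v \<cdot>\<^sub>m lmp_eval k I A0 A z2)"
  then have rc: "r < k" "c < k" by (auto simp: lmp_eval_def)
  have "(\<Sum>i\<in>I. z i * A i $$ (r, c)) =
      u * (\<Sum>i\<in>I. z1 i * A i $$ (r, c)) + v * (\<Sum>i\<in>I. z2 i * A i $$ (r, c))"
    using assms(2) by (simp add: sum_distrib_left sum.distrib[symmetric] algebra_simps)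
  moreover have "A0 $$ (r, c) = u * A0 $$ (r, c) + v * A0 $$ (r, c)"
    using assms(1) by (simp add: distrib_right[symmetric])
  ultimately show "lmp_eval k I A0 A z $$ (r, c) =
      (u \<cdot>\<^sub>m lmp_eval k I A0 A z1 + v \<cdot>\<^sub>m lmp_eval k I A0 A z2) $$ (r, c)"
    using rc by (simp add: lmp_eval_def algebra_simps)
qed (auto simp: lmp_eval_def)

text \<open>
  A linear matrix polynomial is affine in all its variables, including the auxiliary ones, and the
  positive semidefinite matrices form a convex cone. So a convex combination of points of \<open>S\<close> is
  witnessed by the same combination of their auxiliary vectors.
\<close>

lemma semidefinite_representable_convex:
  assumes "semidefinite_representable S"
  shows "convex S"
proof -
  obtain m k A0 and A :: "'a + nat \<Rightarrow> real mat" where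
    S: "S = {x. \<exists>y \<in> carrier_vec m. positive_semidefinite
      (lmp_eval k (UNIV <+> {..<m}) A0 A (case_sum (\<lambda>i. x $ i) (vec_index y)))}"
    using assms by (auto simp: semidefinite_representable_def)
  show ?thesis
  proof (rule convexI)
    fix x1 x2 and u v :: real
    assume x: "x1 \<in> S" "x2 \<in> S" and uv: "0 \<le> u" "0 \<le> v" "u + v = 1"
    let ?E = "\<lambda>x y. lmp_eval k (UNIV <+> {..<m}) A0 A (case_sum (\<lambda>i. x $ i) (vec_index y))"
    obtain y1 y2 where y: "y1 \<in> carrier_vec m" "y2 \<in> carrier_vec m"
      and psd: "positive_semidefinite (?E x1 y1)" "positive_semidefinite (?E x2 y2)"
      using x unfolding S by blast
    have "?E (u *\<^sub>R x1 + v *\<^sub>R x2) (u \<cdot>\<^sub>v y1 + v \<cdot>\<^sub>v y2) = u \<cdot>\<^sub>m ?E x1 y1 + v \<cdot>\<^sub>m ?E x2 y2"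
      using uv(3) y by (intro lmp_eval_affine) auto
    then have "positive_semidefinite (?E (u *\<^sub>R x1 + v *\<^sub>R x2) (u \<cdot>\<^sub>v y1 + v \<cdot>\<^sub>v y2))"
      using psd uv by (auto intro!: positive_semidefinite_add[of _ k] positive_semidefinite_smult[of _ k])
    moreover have "u \<cdot>\<^sub>v y1 + v \<cdot>\<^sub>v y2 \<in> carrier_vec m"
      using y by auto
    ultimately show "u *\<^sub>R x1 + v *\<^sub>R x2 \<in> S"
      unfolding S by blast
  qed
qed

text \<open>
  The segment from \<open>x0\<close> to a relative interior point \<open>x\<close> can be prolonged beyond \<open>x\<close> inside \<open>S\<close>, to a
  point \<open>s\<close>; this makes \<open>x\<close> an inner point of the segment from \<open>x0\<close> to \<open>s\<close>. Conversely, shrinking a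
  convex set towards a relative interior point moves it into its relative interior. In contrast to
  the definition of the relative interior, the right-hand side mentions only membership in
  \<open>S\<close> and two scalar inequalities.
\<close>

lemma rel_interior_eq_open_segments:
  fixes S :: "'a::euclidean_space set"
  assumes "convex S" "x0 \<in> rel_interior S"
  shows "rel_interior S = {t *\<^sub>R s + (1 - t) *\<^sub>R x0 | s t. s \<in> S \<and> 0 < t \<and> t < 1}"
proof (intro Set.set_eqI iffI)
  fix x assume x: "x \<in> rel_interior S"
  have "x0 \<in> S" using assms(2) rel_interior_subset by blast
  then obtain e where e: "e > 1" "(1 - e) *\<^sub>R x0 + e *\<^sub>R x \<in> S"
    using x assms(1) convex_rel_interior_iff[of S x] by auto
  have "x = (1 / e) *\<^sub>R ((1 - e) *\<^sub>R x0 + e *\<^sub>R x) + (1 - 1 / e) *\<^sub>R x0"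
    using e(1) by (simp add: algebra_simps diff_divide_distrib)
  then show "x \<in> {t *\<^sub>R s + (1 - t) *\<^sub>R x0 | s t. s \<in> S \<and> 0 < t \<and> t < 1}"
    using e by force
next
  fix x assume "x \<in> {t *\<^sub>R s + (1 - t) *\<^sub>R x0 | s t. s \<in> S \<and> 0 < t \<and> t < 1}"
  then obtain s t where st: "s \<in> S" "0 < t" "t < 1" "x = t *\<^sub>R s + (1 - t) *\<^sub>R x0" by blast
  have "s - (1 - t) *\<^sub>R (s - x0) \<in> rel_interior S"
    using assms st by (intro rel_interior_convex_shrink) auto
  then show "x \<in> rel_interior S"
    unfolding st(4) by (simp add: algebra_simps)
qed

section \<open>Contracting a spectrahedron towards a point\<close>

text \<open>
  Below, \<open>p\<close> is the fixed point towards which the set is contracted. Writing \<open>A i\<close> for the coefficient of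
  \<open>x i\<close> and \<open>B j\<close> for that of an auxiliary variable, scaling
  \<open>A0 + (\<Sum>i. s i * A i) + (\<Sum>j. w j * B j)\<close> by \<open>t\<close> and substituting
  \<open>t * s i = x i - (1 - t) * p i\<close> and \<open>t * w j = y j\<close> gives
  \<open>- (\<Sum>i. p i * A i) + t * (A0 + (\<Sum>i. p i * A i)) + (\<Sum>i. x i * A i) + (\<Sum>j. y j * B j)\<close>. The first summand
  is \<open>cone_const\<close>. The variable \<open>t\<close> is \<open>Inr m\<close>; the variable \<open>Inr (m + 1)\<close> gets the coefficient zero,
  since it is reserved for the bound \<open>l\<close> that certifies \<open>0 < t < 1\<close>.
\<close>

definition cone_const :: "nat \<Rightarrow> ('n \<Rightarrow> real) \<Rightarrow> ('n::finite + nat \<Rightarrow> real mat) \<Rightarrow> real mat" where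
  "cone_const k p A = mat k k (\<lambda>(r, c). - (\<Sum>i\<in>UNIV. p i * A (Inl i) $$ (r, c)))"

definition cone_coeff ::
  "nat \<Rightarrow> nat \<Rightarrow> ('n \<Rightarrow> real) \<Rightarrow> real mat \<Rightarrow> ('n::finite + nat \<Rightarrow> real mat) \<Rightarrow> 'n + nat \<Rightarrow> real mat"
where
  "cone_coeff k m p A0 A = case_sum (\<lambda>i. A (Inl i))
     (\<lambda>j. if j < m then A (Inr j)
          else if j = m then A0 - cone_const k p A
          else 0\<^sub>m k k)"

lemma linear_matrix_polynomial_cone:
  assumes "linear_matrix_polynomial k (UNIV <+> {..<m}) A0 A"
  shows "linear_matrix_polynomial k (UNIV <+> {..<m + 2}) (cone_const k p A) (cone_coeff k m p A0 A)"
proof -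
  have A0: "A0 \<in> carrier_mat k k" "A0\<^sup>T = A0"
    and A: "\<And>i. i \<in> UNIV <+> {..<m} \<Longrightarrow> A i \<in> carrier_mat k k \<and> (A i)\<^sup>T = A i"
    using assms by (auto simp: linear_matrix_polynomial_def)
  have entry: "A (Inl i) $$ (c, r) = A (Inl i) $$ (r, c)" if "r < k" "c < k" for i r c
    using that A[of "Inl i"] by (metis InlI UNIV_I carrier_matD index_transpose_mat(1))
  have C: "cone_const k p A \<in> carrier_mat k k" "(cone_const k p A)\<^sup>T = cone_const k p A"
    by (auto simp: cone_const_def entry)
  have "(A0 - cone_const k p A)\<^sup>T = A0 - cone_const k p A"
    using A0 C by (simp add: transpose_minus[of _ k k])
  moreover have "A0 - cone_const k p A \<in> carrier_mat k k"
    using C(1) by (rule minus_carrier_mat)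
  ultimately show ?thesis
    using A0 A C by (auto simp: linear_matrix_polynomial_def cone_coeff_def InlI InrI)
qed

text \<open>
  The relation between \<open>(x, y)\<close> and \<open>(s, w)\<close> is stated without division by \<open>t\<close>, so that the identity
  can be used both to construct \<open>(x, y)\<close> from \<open>(s, w)\<close> and to recover \<open>(s, w)\<close> from \<open>(x, y)\<close>.
\<close>

lemma lmp_eval_cone:
  assumes "A0 \<in> carrier_mat k k"
    and "\<And>i. x i = t * s i + (1 - t) * p i"
    and "\<And>j. j < m \<Longrightarrow> y j = t * w j" "y m = t"
  shows "lmp_eval k (UNIV <+> {..<m + 2}) (cone_const k p A) (cone_coeff k m p A0 A) (case_sum x y)
    = t \<cdot>\<^sub>m lmp_eval k (UNIV <+> {..<m}) A0 A (case_sum s w)"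
proof (intro eq_matI)
  fix r c assume "r < dim_row (t \<cdot>\<^sub>m lmp_eval k (UNIV <+> {..<m}) A0 A (case_sum s w))"
    "c < dim_col (t \<cdot>\<^sub>m lmp_eval k (UNIV <+> {..<m}) A0 A (case_sum s w))"
  then have rc: "r < k" "c < k" by (auto simp: lmp_eval_def)
  let ?a = "\<lambda>i. A i $$ (r, c)"
  have "(\<Sum>i\<in>UNIV. x i * ?a (Inl i)) =
      t * (\<Sum>i\<in>UNIV. s i * ?a (Inl i)) + (1 - t) * (\<Sum>i\<in>UNIV. p i * ?a (Inl i))"
    unfolding assms(2) by (simp add: sum_distrib_left sum.distrib[symmetric] distrib_right mult.assoc)
  moreover have "(\<Sum>j<m. y j * ?a (Inr j)) = t * (\<Sum>j<m. w j * ?a (Inr j))"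
    using assms(3) by (simp add: sum_distrib_left mult_ac)
  ultimately show "lmp_eval k (UNIV <+> {..<m + 2}) (cone_const k p A) (cone_coeff k m p A0 A)
      (case_sum x y) $$ (r, c) = (t \<cdot>\<^sub>m lmp_eval k (UNIV <+> {..<m}) A0 A (case_sum s w)) $$ (r, c)"
    using rc assms(1,4)
    by (simp add: lmp_eval_def sum_Plus cone_coeff_def cone_const_def algebra_simps)
qed (auto simp: lmp_eval_def)

section \<open>The open unit interval\<close>

definition matrix_3x3 :: "real list list \<Rightarrow> real mat" where
  "matrix_3x3 xss = mat 3 3 (\<lambda>(r, c). xss ! r ! c)"

text \<open>
  The matrix polynomial with rows \<open>(t, 1, 0)\<close>, \<open>(1, l, 1)\<close>, \<open>(0, 1, 1 - t)\<close>, where \<open>t\<close> is the variable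
  \<open>Inr m\<close> and \<open>l\<close> the variable \<open>Inr (m + 1)\<close>. It is given on the full set of variables
  so that it can be joined to the homogenised polynomial as a diagonal block.
\<close>

definition interval_const :: "real mat" where
  "interval_const = matrix_3x3 [[0, 1, 0], [1, 0, 1], [0, 1, 1]]"

definition interval_coeff :: "nat \<Rightarrow> 'n + nat \<Rightarrow> real mat" where
  "interval_coeff m = case_sum (\<lambda>_. 0\<^sub>m 3 3)
     (\<lambda>j. if j = m then matrix_3x3 [[1, 0, 0], [0, 0, 0], [0, 0, - 1]]
          else if j = m + 1 then matrix_3x3 [[0, 0, 0], [0, 1, 0], [0, 0, 0]]
          else 0\<^sub>m 3 3)"

lemma less_3_iff: "r < 3 \<longleftrightarrow> r = 0 \<or> r = 1 \<or> r = (2::nat)"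
  by auto

lemma symmetric_3x3:
  "matrix_3x3 [[a, b, c], [b, d, e], [c, e, f]] \<in> carrier_mat 3 3"
  "(matrix_3x3 [[a, b, c], [b, d, e], [c, e, f]])\<^sup>T =
    matrix_3x3 [[a, b, c], [b, d, e], [c, e, f]]"
proof -
  show carrier: "matrix_3x3 [[a, b, c], [b, d, e], [c, e, f]] \<in> carrier_mat 3 3"
    by (simp add: matrix_3x3_def)
  show "(matrix_3x3 [[a, b, c], [b, d, e], [c, e, f]])\<^sup>T =
      matrix_3x3 [[a, b, c], [b, d, e], [c, e, f]]"
    by (intro eq_matI) (auto simp: matrix_3x3_def less_3_iff)
qed

lemma linear_matrix_polynomial_interval:
  "linear_matrix_polynomial 3 (UNIV <+> {..<m + 2})
     interval_const (interval_coeff m :: 'n::finite + nat \<Rightarrow> real mat)"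
  by (auto simp: linear_matrix_polynomial_def interval_const_def interval_coeff_def
      symmetric_3x3 split: sum.splits)

lemma lmp_eval_interval:
  "lmp_eval 3 (UNIV <+> {..<m + 2}) interval_const (interval_coeff m :: 'n::finite + nat \<Rightarrow> real mat)
     (case_sum x y) =
   matrix_3x3 [[y m, 1, 0], [1, y (m + 1), 1], [0, 1, 1 - y m]]"
  by (intro eq_matI)
    (auto simp: lmp_eval_def sum_Plus interval_const_def interval_coeff_def matrix_3x3_def
      less_3_iff)

text \<open>
  The upper left and the lower right 2 by 2 block have determinants \<open>t * l - 1\<close> and
  \<open>l * (1 - t) - 1\<close>, which cannot be nonnegative together with the diagonal entries unless
  \<open>t\<close> and \<open>1 - t\<close> are positive. Conversely, for \<open>l = 1 / t + 1 / (1 - t)\<close> the quadratic form splits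
  into two squares, one for each block.
\<close>

lemma positive_semidefinite_interval_iff:
  fixes t :: real
  defines "M \<equiv> \<lambda>l. matrix_3x3 [[t, 1, 0], [1, l, 1], [0, 1, 1 - t]]"
  shows "(\<exists>l. positive_semidefinite (M l)) \<longleftrightarrow> 0 < t \<and> t < 1"
proof -
  have carrier: "M l \<in> carrier_mat 3 3" for l
    unfolding M_def by (rule symmetric_3x3)
  have dim: "dim_row (M l) = 3" for l
    using carrier by (rule carrier_matD)
  have form: "v \<bullet> (M l *\<^sub>v v) =
      t * (vec_index v 0)\<^sup>2 + 2 * vec_index v 0 * vec_index v 1 + l * (vec_index v 1)\<^sup>2
      + 2 * vec_index v 1 * vec_index v 2 + (1 - t) * (vec_index v 2)\<^sup>2"
    if "v \<in> carrier_vec 3" for v l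
    unfolding quadratic_form_expand[OF carrier that]
    by (simp add: M_def matrix_3x3_def numeral_3_eq_3 numeral_2_eq_2 algebra_simps)
  show ?thesis
  proof
    assume "\<exists>l. positive_semidefinite (M l)"
    then obtain l where l: "positive_semidefinite (M l)" ..
    have nonneg: "0 \<le> t * a\<^sup>2 + 2 * a * b + l * b\<^sup>2 + 2 * b * c + (1 - t) * c\<^sup>2" for a b c
    proof -
      let ?v = "vec 3 (\<lambda>i. [a, b, c] ! i)"
      have "0 \<le> ?v \<bullet> (M l *\<^sub>v ?v)"
        using l unfolding positive_semidefinite_def dim by (blast intro: vec_carrier)
      then show ?thesis
        using form[of ?v l] by simp
    qed
    \<comment> \<open>The middle summand outweighs \<open>l\<close>, so the first one must be positive.\<close>
    have pos: "0 < u" if "0 \<le> u * q\<^sup>2 - 2 * q + l" "\<bar>l\<bar> < q" for u q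
    proof -
      have "0 < u * q\<^sup>2"
        using that by linarith
      then show ?thesis
        by (simp add: zero_less_mult_iff)
    qed
    show "0 < t \<and> t < 1"
      using pos[of t "\<bar>l\<bar> + 1"] pos[of "1 - t" "\<bar>l\<bar> + 1"]
        nonneg[of "- (\<bar>l\<bar> + 1)" 1 0] nonneg[of 0 1 "- (\<bar>l\<bar> + 1)"]
      by (simp add: power2_eq_square algebra_simps)
  next
    assume t: "0 < t \<and> t < 1"
    have "positive_semidefinite (M (1 / t + 1 / (1 - t)))"
      unfolding positive_semidefinite_def
    proof (intro conjI ballI)
      show "(M (1 / t + 1 / (1 - t)))\<^sup>T = M (1 / t + 1 / (1 - t))"
        unfolding M_def by (rule symmetric_3x3)
    next
      fix v :: "real vec" assume "v \<in> carrier_vec (dim_row (M (1 / t + 1 / (1 - t))))"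
      then have v: "v \<in> carrier_vec 3" by (simp only: dim)
      have square: "u * a\<^sup>2 + 2 * a * b + b\<^sup>2 / u = (u * a + b)\<^sup>2 / u" if "0 < u" for u a b :: real
        using that by (simp add: power2_eq_square field_simps)
      have "v \<bullet> (M (1 / t + 1 / (1 - t)) *\<^sub>v v) =
          (t * vec_index v 0 + vec_index v 1)\<^sup>2 / t
          + ((1 - t) * vec_index v 2 + vec_index v 1)\<^sup>2 / (1 - t)"
        using t square[of t "vec_index v 0" "vec_index v 1"]
          square[of "1 - t" "vec_index v 2" "vec_index v 1"]
        unfolding form[OF v] by (simp add: algebra_simps)
      then show "0 \<le> v \<bullet> (M (1 / t + 1 / (1 - t)) *\<^sub>v v)"
        using t by simp
    qed
    then show "\<exists>l. positive_semidefinite (M l)" ..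
  qed
qed

section \<open>Representability of the relative interior\<close>

theorem proposition3p2:
  fixes S :: "(real ^ 'n) set"
  assumes "semidefinite_representable S"
  shows "semidefinite_representable (rel_interior S)"
proof (cases "S = {}")
  case True
  then show ?thesis using assms by simp
next
  case False
  have "convex S" using assms by (rule semidefinite_representable_convex)
  then obtain x0 where x0: "x0 \<in> rel_interior S"
    using False rel_interior_eq_empty by blast
  obtain m k A0 and A :: "'n + nat \<Rightarrow> real mat" where
    A: "linear_matrix_polynomial k (UNIV <+> {..<m}) A0 A" and
    S: "S = {x. \<exists>y \<in> carrier_vec m. positive_semidefinite
      (lmp_eval k (UNIV <+> {..<m}) A0 A (case_sum (\<lambda>i. x $ i) (vec_index y)))}"
    using assms by (auto simp: semidefinite_representable_def)
  let ?I = "UNIV <+> {..<m + 2}"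
  let ?E = "\<lambda>x y. lmp_eval k (UNIV <+> {..<m}) A0 A (case_sum (\<lambda>i. x $ i) (vec_index y))"
  let ?Cconst = "cone_const k (\<lambda>i. x0 $ i) A" and ?C = "cone_coeff k m (\<lambda>i. x0 $ i) A0 A"
  let ?J = "interval_coeff m :: 'n + nat \<Rightarrow> real mat"
  let ?Bconst = "block_sum ?Cconst interval_const" and ?B = "\<lambda>i. block_sum (?C i) (?J i)"
  have cone: "linear_matrix_polynomial k ?I ?Cconst ?C"
    using A by (rule linear_matrix_polynomial_cone)
  have interval: "linear_matrix_polynomial 3 ?I interval_const ?J"
    by (rule linear_matrix_polynomial_interval)
  have A0: "A0 \<in> carrier_mat k k"
    using A by (simp add: linear_matrix_polynomial_def)
  have psd_iff: "positive_semidefinite (lmp_eval (k + 3) ?I ?Bconst ?B (case_sum (\<lambda>i. x $ i) (vec_index y)))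
    \<longleftrightarrow> positive_semidefinite (lmp_eval k ?I ?Cconst ?C (case_sum (\<lambda>i. x $ i) (vec_index y))) \<and>
      positive_semidefinite (matrix_3x3
        [[vec_index y m, 1, 0], [1, vec_index y (m + 1), 1], [0, 1, 1 - vec_index y m]])" for x y
    unfolding lmp_eval_interval[where 'n = 'n, of m "\<lambda>i. x $ i" "vec_index y", symmetric]
    using cone interval
    by (subst lmp_eval_block_sum)
      (simp_all add: linear_matrix_polynomial_def positive_semidefinite_block_sum[of _ k _ 3])
  have "x \<in> rel_interior S \<longleftrightarrow> (\<exists>y \<in> carrier_vec (m + 2).
      positive_semidefinite (lmp_eval (k + 3) ?I ?Bconst ?B (case_sum (\<lambda>i. x $ i) (vec_index y))))" for x
  proof
    assume "x \<in> rel_interior S"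
    then obtain s t where s: "s \<in> S" and t: "0 < t" "t < 1"
      and x: "x = t *\<^sub>R s + (1 - t) *\<^sub>R x0"
      unfolding rel_interior_eq_open_segments[OF \<open>convex S\<close> x0] by blast
    obtain w where w: "w \<in> carrier_vec m" "positive_semidefinite (?E s w)"
      using s unfolding S by blast
    obtain l where l: "positive_semidefinite (matrix_3x3 [[t, 1, 0], [1, l, 1], [0, 1, 1 - t]])"
      using t positive_semidefinite_interval_iff[of t] by blast
    define y where "y = vec (m + 2) (\<lambda>j. if j < m then t * vec_index w j else if j = m then t else l)"
    have "lmp_eval k ?I ?Cconst ?C (case_sum (\<lambda>i. x $ i) (vec_index y)) = t \<cdot>\<^sub>m ?E s w"
      using A0 x w(1) by (intro lmp_eval_cone) (auto simp: y_def)
    then have "positive_semidefinite (lmp_eval k ?I ?Cconst ?C (case_sum (\<lambda>i. x $ i) (vec_index y)))"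
      using w(2) t by (simp add: positive_semidefinite_smult[of _ k])
    moreover have "vec_index y m = t" "vec_index y (m + 1) = l" "y \<in> carrier_vec (m + 2)"
      by (auto simp: y_def)
    ultimately show "\<exists>y \<in> carrier_vec (m + 2).
      positive_semidefinite (lmp_eval (k + 3) ?I ?Bconst ?B (case_sum (\<lambda>i. x $ i) (vec_index y)))"
      using l psd_iff by auto
  next
    assume "\<exists>y \<in> carrier_vec (m + 2).
      positive_semidefinite (lmp_eval (k + 3) ?I ?Bconst ?B (case_sum (\<lambda>i. x $ i) (vec_index y)))"
    then obtain y where
      C: "positive_semidefinite (lmp_eval k ?I ?Cconst ?C (case_sum (\<lambda>i. x $ i) (vec_index y)))" and
      J: "positive_semidefinite (matrix_3x3
        [[vec_index y m, 1, 0], [1, vec_index y (m + 1), 1], [0, 1, 1 - vec_index y m]])"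
      using psd_iff by blast
    define t where "t = vec_index y m"
    define s where "s = (1 / t) *\<^sub>R (x - (1 - t) *\<^sub>R x0)"
    define w where "w = vec m (\<lambda>j. vec_index y j / t)"
    have t: "0 < t" "t < 1"
      using J positive_semidefinite_interval_iff[of t] unfolding t_def by blast+
    have x: "x = t *\<^sub>R s + (1 - t) *\<^sub>R x0"
      using t by (simp add: s_def)
    have "lmp_eval k ?I ?Cconst ?C (case_sum (\<lambda>i. x $ i) (vec_index y)) = t \<cdot>\<^sub>m ?E s w"
      using A0 x t by (intro lmp_eval_cone) (auto simp: w_def t_def)
    then have "positive_semidefinite (?E s w)"
      using C t by (simp add: positive_semidefinite_smult_iff[of _ k])
    then have "s \<in> S"
      unfolding S by (auto simp: w_def)
    then show "x \<in> rel_interior S"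
      unfolding rel_interior_eq_open_segments[OF \<open>convex S\<close> x0] using x t by blast
  qed
  then have "rel_interior S = {x. \<exists>y \<in> carrier_vec (m + 2).
      positive_semidefinite (lmp_eval (k + 3) ?I ?Bconst ?B (case_sum (\<lambda>i. x $ i) (vec_index y)))}"
    by blast
  moreover have "linear_matrix_polynomial (k + 3) ?I ?Bconst ?B"
    using cone interval by (rule linear_matrix_polynomial_block_sum)
  ultimately show ?thesis
    unfolding semidefinite_representable_def by blast
qed

end
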